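(* Let $f:\mathbb{N}\to\mathbb{C}$ be a nonzero multiplicative function. The following conditions are equivalent: (a) $f$ is automatic nonsingular. (b) $f$ is either periodic or nonperiodic Toeplitz, and in the latter case there exists a unique prime $p$ with $\nu_p(Per(f))=\infty$, and the sequence $(f(p^k))_k$ is eventually periodic for this $p$.
   Context: $\mathbb{N}=\{1,2,\ldots\}$, $\mathbb{N}_0=\mathbb{N}\cup\{0\}$; $\nu_p(n)$ is the $p$-adic valuation of $n$. Multiplicative means $f(mn)=f(m)f(n)$ for all coprime $m,n$. Automatic: a sequence $(a_n)$ is $r$-automatic ($r\ge2$) if its $r$-kernel, i.e. the family of sequences $n\mapsto a_{r^kn+j}$, $k\ge1$, $0\le j<r^k$, is finite; it is automatic if it is $r$-automatic for some $r\geq 2$. It is known that every multiplicative automatic sequence $(a_n)_{n\ge1}$ (nonzero) can be written as $$a_n=f_1(\nu_p(n))\,f_2\Big(\frac{n}{p^{\nu_p(n)}}\Big)\qquad(\star)$$ for some prime $p$, some eventually periodic $f_1:\mathbb{N}_0\to\mathbb{C}$ with $f_1(0)=1$, and some eventually periodic multiplicative $f_2:\mathbb{N}\to\mathbb{C}$ with $f_2(p^k)=0$ for all $k\ge1$. An automatic multiplicative sequence is nonsingular if it admits a presentation $(\star)$ with $f_2$ nonzero and periodic. Toeplitz: for $m\ge1$ put $Per_m(f)=\{n\in\mathbb{N}: f(n)=f(n')\text{ for all }n'\in\mathbb{N},\ n'\equiv n\bmod m\}$; $f$ is Toeplitz if $\mathbb{N}=\bigcup_m Per_m(f)$. The $m$-skeleton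 of $f$ is the $m$-periodic sequence obtained from $f$ by replacing the values at positions in $\mathbb{N}\setminus Per_m(f)$ by a new symbol; $m$ is an essential period of $f$ if $m$ is the smallest period of the $m$-skeleton. A period structure of $f$ is a sequence $m_1|m_2|\ldots$ of essential periods with $\mathbb{N}=\bigcup_kPer_{m_k}(f)$. For a prime $p$, $\nu_p(Per(f))$ is the largest $b\in\mathbb{N}_0$ such that $p^b$ divides some $m_i$ if such $b$ exists, and $\nu_p(Per(f))=\infty$ otherwise; this does not depend on the choice of the period structure. *)

theory Defs
  imports Complex_Main "HOL-Library.FuncSet" "HOL-Library.Extended_Nat"
    "HOL-Computational_Algebra.Primes"
begin

text \<open>
  Functions on the positive integers are represented by functions on \<^typ>\<open>nat\<close> whose value at 0
  is never inspected. The exceptions are \<open>eventually_periodic\<close>, where it is immaterial, and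
  the function \<open>f1\<close> below, which lives on all of \<^typ>\<open>nat\<close>.
\<close>

definition multiplicative :: "(nat \<Rightarrow> complex) \<Rightarrow> bool" where
  "multiplicative f \<longleftrightarrow> (\<forall>m\<ge>1. \<forall>n\<ge>1. coprime m n \<longrightarrow> f (m * n) = f m * f n)"

definition has_period :: "(nat \<Rightarrow> 'a) \<Rightarrow> nat \<Rightarrow> bool" where
  "has_period g d \<longleftrightarrow> d \<ge> 1 \<and> (\<forall>n\<ge>1. g (n + d) = g n)"

definition periodic :: "(nat \<Rightarrow> 'a) \<Rightarrow> bool" where
  "periodic g \<longleftrightarrow> (\<exists>d. has_period g d)"

definition eventually_periodic :: "(nat \<Rightarrow> 'a) \<Rightarrow> bool" where
  "eventually_periodic g \<longleftrightarrow> (\<exists>d\<ge>1. \<exists>N. \<forall>n\<ge>N. g (n + d) = g n)"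

text \<open>The kernel sequences are indexed by \<open>n \<ge> 1\<close>; restricting them to \<open>{1..}\<close>
  makes two of them equal iff they agree there.\<close>

definition kernel :: "nat \<Rightarrow> (nat \<Rightarrow> complex) \<Rightarrow> (nat \<Rightarrow> complex) set" where
  "kernel r a = {restrict (\<lambda>n. a (r ^ k * n + j)) {1..} | k j. k \<ge> 1 \<and> j < r ^ k}"

definition automatic :: "(nat \<Rightarrow> complex) \<Rightarrow> bool" where
  "automatic a \<longleftrightarrow> (\<exists>r\<ge>2. finite (kernel r a))"

definition presentation ::
    "(nat \<Rightarrow> complex) \<Rightarrow> nat \<Rightarrow> (nat \<Rightarrow> complex) \<Rightarrow> (nat \<Rightarrow> complex) \<Rightarrow> bool" where
  "presentation a p f1 f2 \<longleftrightarrow>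
     prime p \<and>
     eventually_periodic f1 \<and> f1 0 = 1 \<and>
     eventually_periodic f2 \<and> multiplicative f2 \<and> (\<forall>k\<ge>1. f2 (p ^ k) = 0) \<and>
     (\<forall>n\<ge>1. a n = f1 (multiplicity p n) * f2 (n div p ^ multiplicity p n))"

definition nonsingular :: "(nat \<Rightarrow> complex) \<Rightarrow> bool" where
  "nonsingular a \<longleftrightarrow>
     (\<exists>p f1 f2. presentation a p f1 f2 \<and> (\<exists>n\<ge>1. f2 n \<noteq> 0) \<and> periodic f2)"

definition Per :: "nat \<Rightarrow> (nat \<Rightarrow> complex) \<Rightarrow> nat set" where
  "Per m f = {n. n \<ge> 1 \<and> (\<forall>n'\<ge>1. n' mod m = n mod m \<longrightarrow> f n = f n')}"

definition toeplitz :: "(nat \<Rightarrow> complex) \<Rightarrow> bool" where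
  "toeplitz f \<longleftrightarrow> {1..} = (\<Union>m\<in>{1..}. Per m f)"

text \<open>\<^const>\<open>None\<close> plays the role of the new symbol.\<close>

definition skeleton :: "nat \<Rightarrow> (nat \<Rightarrow> complex) \<Rightarrow> nat \<Rightarrow> complex option" where
  "skeleton m f n = (if n \<in> Per m f then Some (f n) else None)"

definition essential_period :: "(nat \<Rightarrow> complex) \<Rightarrow> nat \<Rightarrow> bool" where
  "essential_period f m \<longleftrightarrow>
     has_period (skeleton m f) m \<and> (\<forall>d. has_period (skeleton m f) d \<longrightarrow> m \<le> d)"

definition period_structure :: "(nat \<Rightarrow> complex) \<Rightarrow> (nat \<Rightarrow> nat) \<Rightarrow> bool" where
  "period_structure f m \<longleftrightarrow>
     (\<forall>k. essential_period f (m k)) \<and> (\<forall>k. m k dvd m (Suc k)) \<and>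
     {1..} = (\<Union>k. Per (m k) f)"

text \<open>Every Toeplitz \<open>f\<close> has a period structure, and the value below does not depend on which one
  is chosen; for other \<open>f\<close> it is meaningless. The set \<open>B\<close> contains 0 and is downward closed,
  so it has a largest element iff it is finite.\<close>

definition nu_Per :: "nat \<Rightarrow> (nat \<Rightarrow> complex) \<Rightarrow> enat" where
  "nu_Per p f =
     (let m = (SOME m. period_structure f m); B = {b. \<exists>i. p ^ b dvd m i}
      in if finite B then enat (Max B) else \<infinity>)"

end

theory Submission
  imports Defs "HOL-Number_Theory.Cong"
begin

text \<open>
  If \<open>f n = f1 (\<nu>\<^sub>p n) * f2 (n / p ^ \<nu>\<^sub>p n)\<close> with \<open>f2\<close> of period \<open>d\<close>, then every \<open>n\<close> lies in
  some \<open>Per (p ^ L * d) f\<close>. By the Chinese remainder theorem every essential period divides some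
  \<open>p ^ L * d\<close>; hence \<open>p\<close> is the only prime that can have unbounded exponent in the period structure,
  and if its exponent is bounded too, \<open>f\<close> is periodic.

  Conversely, let \<open>1 \<in> Per m f\<close>. Multiplicativity makes \<open>f\<close> an \<open>m\<close>-periodic function on the
  integers coprime to \<open>m\<close>, so every \<open>n\<close> lies in some \<open>Per (m ^ L) f\<close> and the essential periods
  involve only the primes dividing \<open>m\<close>. As only \<open>p\<close> has unbounded exponent, every \<open>n\<close> lies in
  some \<open>Per (p ^ L * Q) f\<close> with \<open>Q\<close> fixed. For \<open>n\<close> prime to \<open>p\<close> the dependence on \<open>L\<close> is
  removed by multiplying with a suitable \<open>k\<close> with \<open>f k = 1\<close>, and the \<open>p\<close>-free part of \<open>f\<close> is
  periodic.
\<close>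

section \<open>Periods and essential periods\<close>

lemma PerI:
  assumes "n \<ge> 1" "\<And>n'. n' \<ge> 1 \<Longrightarrow> [n' = n] (mod m) \<Longrightarrow> f n' = f n"
  shows "n \<in> Per m f"
proof -
  have "f n = f n'" if "n' \<ge> 1" "n' mod m = n mod m" for n'
    using assms(2)[of n'] that by (simp add: cong_def)
  then show ?thesis using assms(1) unfolding Per_def by blast
qed

lemma PerD:
  assumes "n \<in> Per m f" "n' \<ge> 1" "[n' = n] (mod m)"
  shows "f n' = f n" "n' \<in> Per m f"
proof -
  have eq: "f x = f n" if "x \<ge> 1" "[x = n] (mod m)" for x
  proof -
    have "f n = f x" using assms(1) that unfolding Per_def cong_def by blast
    then show ?thesis ..
  qed
  show "f n' = f n" using eq assms(2,3) .
  show "n' \<in> Per m f"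
  proof (rule PerI[OF assms(2)])
    fix x assume "x \<ge> 1" "[x = n'] (mod m)"
    then have "f x = f n" using eq cong_trans assms(3) by blast
    then show "f x = f n'" using eq[OF assms(2,3)] by simp
  qed
qed

lemma one_le_of_Per: "n \<in> Per m f \<Longrightarrow> n \<ge> 1"
  by (simp add: Per_def)

lemma Per_mono: "a dvd b \<Longrightarrow> Per a f \<subseteq> Per b f"
proof
  fix n assume "a dvd b" and n: "n \<in> Per a f"
  then show "n \<in> Per b f"
    by (intro PerI PerD(1)[OF n] one_le_of_Per[OF n]) (auto elim: cong_dvd_modulus_nat)
qed

lemma has_period_cong:
  assumes "has_period g d" "n \<ge> 1" "n' \<ge> 1" "[n' = n] (mod d)"
  shows "g n' = g n"
proof -
  have step: "g (n + k * d) = g n" if "n \<ge> 1" for n k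
  proof (induction k)
    case (Suc k)
    have "g (n + k * d + d) = g (n + k * d)"
      using that assms(1) unfolding has_period_def by simp
    then show ?case using Suc by (simp add: ac_simps)
  qed simp
  have *: "g y = g x" if xy: "x \<ge> 1" "x \<le> y" "[y = x] (mod d)" for x y
  proof -
    obtain k where "y = k * d + x"
      using xy(3) unfolding cong_le_nat[OF xy(2)] by blast
    then show ?thesis
      using step[OF xy(1)] by (simp add: add.commute)
  qed
  show ?thesis
  proof (cases "n \<le> n'")
    case True
    then show ?thesis using *[of n n'] assms by simp
  next
    case False
    then show ?thesis using *[of n' n] assms by (simp add: cong_sym)
  qed
qed

lemma has_period_of_cong:
  assumes "d \<ge> 1" "\<And>n n'. n \<ge> 1 \<Longrightarrow> n' \<ge> 1 \<Longrightarrow> [n' = n] (mod d) \<Longrightarrow> g n' = g n"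
  shows "has_period g d"
  unfolding has_period_def
proof (intro conjI allI impI)
  fix n :: nat assume "n \<ge> 1"
  then show "g (n + d) = g n"
    by (intro assms(2)) (simp_all add: cong_def)
qed (rule assms(1))

lemma has_period_skeleton: "m \<ge> 1 \<Longrightarrow> has_period (skeleton m f) m"
proof (rule has_period_of_cong)
  fix n n' assume *: "n \<ge> 1" "n' \<ge> 1" "[n' = n] (mod m)"
  have "n' \<in> Per m f \<longleftrightarrow> n \<in> Per m f"
    using PerD(2)[OF _ *(2,3)] PerD(2)[OF _ *(1) cong_sym[OF *(3)]] by blast
  then show "skeleton m f n' = skeleton m f n"
    using PerD(1)[of n m f n'] * by (simp add: skeleton_def)
qed

text \<open>At positions of \<open>Per m f\<close> the skeleton shows the value of \<open>f\<close>
  and never \<open>None\<close>, so equality of skeleton entries passes to \<open>f\<close>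
  itself.\<close>

lemma Per_subset_of_skeleton_period:
  assumes "has_period (skeleton m f) d"
  shows "Per m f \<subseteq> Per d f"
proof
  fix n assume n: "n \<in> Per m f"
  then have "n \<ge> 1" by (simp add: Per_def)
  then show "n \<in> Per d f"
  proof (rule PerI)
    fix n' assume "n' \<ge> 1" "[n' = n] (mod d)"
    then have "skeleton m f n' = skeleton m f n"
      using has_period_cong[OF assms] \<open>n \<ge> 1\<close> by blast
    then show "f n' = f n"
      using n by (auto simp: skeleton_def split: if_splits)
  qed
qed

section \<open>Gluing residue classes with the Chinese remainder theorem\<close>

lemma chinese_remainder_gcd_nat:
  fixes a b n n' :: nat
  assumes "[n = n'] (mod gcd a b)" "n \<ge> 1" "b > 0"
  obtains x where "x \<ge> 1" "[x = n] (mod a)" "[x = n'] (mod b)"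
proof -
  \<comment> \<open>Passing to \<open>n' + b * n\<close> keeps the class modulo \<open>b\<close> and
    makes the gap to \<open>n\<close> a natural number.\<close>
  have "[n = n' + b * n] (mod gcd a b)"
  proof -
    have "[n' + b * n = n' + 0] (mod gcd a b)"
      by (intro cong_add) (auto simp: cong_0_iff)
    then show ?thesis using assms(1) by (metis add_0_right cong_sym cong_trans)
  qed
  moreover have "n \<le> n' + b * n"
    using assms(3) by (cases b) auto
  ultimately obtain t where t: "n' + b * n = t * gcd a b + n"
    by (metis cong_le_nat cong_sym)
  obtain x where x: "[a * x = gcd a b] (mod b)"
    using cong_solve_nat by blast
  show ?thesis
  proof
    show "n + a * x * t \<ge> 1" using assms(2) by simp
    show "[n + a * x * t = n] (mod a)"
      by (simp add: cong_def mult.assoc)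
    have "[n + a * x * t = n + gcd a b * t] (mod b)"
      using x by (intro cong_add cong_mult) auto
    also have "n + gcd a b * t = n' + b * n" using t by (simp add: mult.commute)
    also have "[n' + b * n = n'] (mod b)" by (simp add: cong_def)
    finally show "[n + a * x * t = n'] (mod b)" .
  qed
qed

text \<open>The class of \<open>n\<close> modulo \<open>a\<close> and that of \<open>n'\<close>
  modulo \<open>b\<close> share a positive element, where \<open>f\<close> takes both
  values.\<close>

lemma Per_glue:
  assumes "n \<in> Per a f" "n' \<in> Per b f" "[n = n'] (mod gcd a b)" "b > 0"
  shows "f n' = f n"
proof -
  have "n \<ge> 1" using assms(1) by (simp add: Per_def)
  obtain x where "x \<ge> 1" "[x = n] (mod a)" "[x = n'] (mod b)"
    using chinese_remainder_gcd_nat[OF assms(3) \<open>n \<ge> 1\<close> assms(4)] .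
  then show ?thesis
    using PerD(1)[OF assms(1)] PerD(1)[OF assms(2)] by metis
qed

text \<open>For \<open>n'\<close> in the class of \<open>n\<close> modulo the gcd, some
  \<open>x\<close> is congruent to \<open>n\<close> modulo \<open>a\<close> and to \<open>n'\<close>
  modulo \<open>b\<close>. It lies in \<open>Per a f\<close>, hence in \<open>Per b f\<close>, and
  links \<open>f n\<close> to \<open>f n'\<close>.\<close>

lemma Per_gcd:
  assumes "Per a f \<subseteq> Per b f" "a > 0" "b > 0"
  shows "Per (gcd a b) f = Per a f"
proof
  show "Per (gcd a b) f \<subseteq> Per a f" by (simp add: Per_mono)
  show "Per a f \<subseteq> Per (gcd a b) f"
  proof
    fix n assume n: "n \<in> Per a f"
    then have "n \<ge> 1" by (simp add: Per_def)
    then show "n \<in> Per (gcd a b) f"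
    proof (rule PerI)
      fix n' assume n': "n' \<ge> 1" "[n' = n] (mod gcd a b)"
      obtain x where x: "x \<ge> 1" "[x = n] (mod a)" "[x = n'] (mod b)"
        using chinese_remainder_gcd_nat[OF cong_sym[OF n'(2)] \<open>n \<ge> 1\<close> assms(3)] .
      have "x \<in> Per b f" using PerD(2)[OF n x(1,2)] assms(1) by blast
      then have "f n' = f x" using PerD(1) n'(1) x(3) cong_sym by blast
      then show "f n' = f n" using PerD(1)[OF n x(1,2)] by simp
    qed
  qed
qed

section \<open>Essential periods as least moduli with a given \<open>Per\<close> set\<close>

lemma essential_period_pos: "essential_period f m \<Longrightarrow> m > 0"
  by (auto simp: essential_period_def has_period_def)

lemma essential_period_le:
  assumes "essential_period f m" "Per d f = Per m f" "d > 0"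
  shows "m \<le> d"
proof -
  have "skeleton m f = skeleton d f"
    using assms(2) by (simp add: skeleton_def fun_eq_iff)
  then show ?thesis
    using assms has_period_skeleton[of d f] by (simp add: essential_period_def)
qed

text \<open>By \<open>Per_gcd\<close>, a skeleton period \<open>d\<close> can be replaced by
  \<open>gcd m d\<close>, which has the same \<open>Per\<close> set as \<open>m\<close>. So
  minimality among moduli with this set gives minimality among skeleton periods.\<close>

lemma essential_period_least:
  assumes "m > 0" "\<And>d. d > 0 \<Longrightarrow> Per d f = Per m f \<Longrightarrow> m \<le> d"
  shows "essential_period f m"
  unfolding essential_period_def
proof (intro conjI allI impI)
  show "has_period (skeleton m f) m" using has_period_skeleton assms(1) by simp
next
  fix d assume d: "has_period (skeleton m f) d"
  then have "d > 0" by (simp add: has_period_def)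
  have "Per (gcd m d) f = Per m f"
    using Per_gcd[OF Per_subset_of_skeleton_period[OF d] assms(1) \<open>d > 0\<close>] .
  then have "m \<le> gcd m d"
    using assms(1) by (intro assms(2)) auto
  also have "\<dots> \<le> d" using \<open>d > 0\<close> by (simp add: gcd_le2_nat)
  finally show "m \<le> d" .
qed

text \<open>An index \<open>K\<close> maximising \<open>gcd m (M k)\<close> gives \<open>Per m f = Per (gcd m (M K)) f\<close>.\<close>
lemma essential_period_dvd_chain:
  assumes ess: "essential_period f m"
    and pos: "\<And>k. M k > 0" and chain: "\<And>k. M k dvd M (Suc k)"
    and cover: "\<And>n. n \<ge> 1 \<Longrightarrow> \<exists>k. n \<in> Per (M k) f"
  shows "\<exists>k. m dvd M k"
proof -
  have m: "m > 0" using ess by (rule essential_period_pos)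
  define S where "S = range (\<lambda>k. gcd m (M k))"
  have "S \<subseteq> {..m}" using m by (auto simp: S_def intro: gcd_le1_nat)
  then have fin: "finite S" using finite_subset by blast
  have "Max S \<in> S"
    by (intro Max_in[OF fin]) (auto simp: S_def)
  then obtain K where K: "Max S = gcd m (M K)"
    unfolding S_def by blast
  have mono: "M i dvd M j" if "i \<le> j" for i j
    using that by (induction rule: dec_induct) (auto intro: dvd_trans chain)
  define G where "G = gcd m (M K)"
  have dvd: "gcd m (M k) dvd G" for k
  proof (cases "k \<le> K")
    case True
    then show ?thesis unfolding G_def using mono by (intro gcd_mono) auto
  next
    case False
    then have "G dvd gcd m (M k)" unfolding G_def using mono by (intro gcd_mono) auto
    moreover have "gcd m (M k) \<le> G"
      using K Max_ge[OF fin] by (simp add: G_def S_def)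
    ultimately have "G = gcd m (M k)"
      using m dvd_imp_le[of G "gcd m (M k)"] by simp
    then show ?thesis by simp
  qed
  \<comment> \<open>\<open>Per_glue\<close> applies whichever \<open>M k\<close> covers
    \<open>n'\<close>, because \<open>gcd m (M k)\<close> divides \<open>G\<close>.\<close>
  have "Per m f \<subseteq> Per G f"
  proof
    fix n assume n: "n \<in> Per m f"
    then have "n \<ge> 1" by (simp add: Per_def)
    then show "n \<in> Per G f"
    proof (rule PerI)
      fix n' assume "n' \<ge> 1" "[n' = n] (mod G)"
      moreover obtain k where "n' \<in> Per (M k) f" using cover[OF \<open>n' \<ge> 1\<close>] by blast
      ultimately show "f n' = f n"
        using Per_glue[OF n] pos dvd by (metis cong_dvd_modulus_nat cong_sym)
    qed
  qed
  then have "Per G f = Per m f"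
    using Per_mono[of G m f] by (auto simp: G_def)
  then have "m \<le> G" using essential_period_le[OF ess] m by (simp add: G_def)
  moreover have "G dvd m" by (simp add: G_def)
  ultimately have "G = m" using m dvd_imp_le by (metis le_antisym)
  then show ?thesis unfolding G_def by (metis gcd_dvd2)
qed

section \<open>Existence of period structures and infinite exponents\<close>

text \<open>The factorials form a divisibility chain containing a multiple of every modulus.
  Shrinking each to the least modulus with the same \<open>Per\<close> set gives essential periods,
  and \<open>Per_gcd\<close> preserves the chain.\<close>

lemma toeplitz_imp_period_structure:
  assumes "toeplitz f"
  shows "\<exists>e. period_structure f e"
proof -
  define M where "M = (\<lambda>k. fact k :: nat)"
  define e where "e = (\<lambda>k. LEAST d. d > 0 \<and> Per d f = Per (M k) f)"
  have e: "e k > 0 \<and> Per (e k) f = Per (M k) f" for k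
    unfolding e_def by (rule LeastI[of _ "M k"]) (simp add: M_def)
  have le: "e k \<le> d" if "d > 0" "Per d f = Per (M k) f" for d k
    unfolding e_def using that by (intro Least_le) simp
  have "essential_period f (e k)" for k
  proof (rule essential_period_least)
    fix d assume "d > 0" "Per d f = Per (e k) f"
    then show "e k \<le> d" using e[of k] by (intro le) simp_all
  qed (use e in blast)
  moreover have "e k dvd e (Suc k)" for k
  proof -
    have "M k dvd M (Suc k)" by (simp add: M_def fact_dvd)
    then have "Per (M k) f \<subseteq> Per (M (Suc k)) f" by (rule Per_mono)
    then have "Per (gcd (e k) (e (Suc k))) f = Per (e k) f"
      using e[of k] e[of "Suc k"] by (intro Per_gcd) simp_all
    then have "e k \<le> gcd (e k) (e (Suc k))"
      using e[of k] by (intro le) simp_all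
    then have "e k = gcd (e k) (e (Suc k))"
      using e[of k] by (intro le_antisym gcd_le1_nat) simp_all
    then show ?thesis by (metis gcd_dvd2)
  qed
  moreover have "{1..} = (\<Union>k. Per (e k) f)"
  proof -
    have "n \<in> (\<Union>k. Per (e k) f)" if n: "n \<ge> 1" for n
    proof -
      obtain m where m: "m \<ge> 1" "n \<in> Per m f"
        using assms n unfolding toeplitz_def by (metis UN_E atLeast_iff)
      then have "m dvd M m" by (simp add: M_def dvd_fact)
      then have "n \<in> Per (e m) f" using Per_mono m(2) e[of m] by blast
      then show ?thesis by blast
    qed
    then show ?thesis by (auto simp: Per_def)
  qed
  ultimately show ?thesis unfolding period_structure_def by blast
qed

text \<open>The structure is the one that \<open>SOME\<close> picks inside \<open>nu_Per\<close>. It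
  is the same for all \<open>p\<close>, so exponents at different primes are read off from one
  sequence \<open>e\<close>.\<close>

lemma toeplitz_nu_Per:
  assumes "toeplitz f"
  obtains e where "period_structure f e"
    and "\<And>p. nu_Per p f = \<infinity> \<longleftrightarrow> (\<forall>b. \<exists>i. p ^ b dvd e i)"
proof
  let ?e = "SOME m. period_structure f m"
  show "period_structure f ?e"
    using toeplitz_imp_period_structure[OF assms] by (rule someI_ex)
  fix p :: nat
  define B where "B = {b. \<exists>i. p ^ b dvd ?e i}"
  have down: "b \<in> B" if b: "b \<le> b'" "b' \<in> B" for b b'
  proof -
    obtain i where "p ^ b' dvd ?e i" using b(2) unfolding B_def by blast
    then have "p ^ b dvd ?e i" by (rule dvd_trans[OF le_imp_power_dvd[OF b(1)]])
    then show ?thesis unfolding B_def by blast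
  qed
  have "infinite B \<longleftrightarrow> (\<forall>b. b \<in> B)"
  proof
    assume "infinite B"
    then show "\<forall>b. b \<in> B"
      using down unfolding infinite_nat_iff_unbounded_le by blast
  next
    assume "\<forall>b. b \<in> B"
    then have "B = UNIV" by blast
    then show "infinite B" by simp
  qed
  moreover have "nu_Per p f = (if finite B then enat (Max B) else \<infinity>)"
    unfolding nu_Per_def Let_def B_def ..
  ultimately have "nu_Per p f = \<infinity> \<longleftrightarrow> (\<forall>b. b \<in> B)"
    by (cases "finite B") auto
  then show "nu_Per p f = \<infinity> \<longleftrightarrow> (\<forall>b. \<exists>i. p ^ b dvd ?e i)"
    unfolding B_def mem_Collect_eq .
qed

section \<open>Nonsingular sequences are automatic and Toeplitz\<close>

lemma eventually_periodic_finite_range: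
  assumes "eventually_periodic g"
  shows "finite (range g)"
proof -
  obtain d N where d: "d \<ge> 1" "\<And>n. n \<ge> N \<Longrightarrow> g (n + d) = g n"
    using assms unfolding eventually_periodic_def by blast
  have "g n \<in> g ` {..<N + d}" for n
  proof (induction n rule: less_induct)
    case (less n)
    show ?case
    proof (cases "n < N + d")
      case False
      then have "g n = g (n - d)" using d(2)[of "n - d"] by simp
      then show ?thesis using less[of "n - d"] False d(1) by simp
    qed auto
  qed
  then have "range g \<subseteq> g ` {..<N + d}" by blast
  then show ?thesis by (rule finite_subset) simp
qed

lemma presentation_multiplicity:
  assumes "presentation a p f1 f2" "\<not> p dvd u" "u > 0"
  shows "a (p ^ s * u) = f1 s * f2 u"
proof -
  have p: "prime p" using assms(1) by (simp add: presentation_def)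
  have "multiplicity p (p ^ s * u) = s"
    using assms p by (intro multiplicity_eqI) auto
  moreover have "p ^ s * u \<ge> 1" using assms(3) prime_gt_0_nat[OF p] by simp
  ultimately show ?thesis
    using assms(1) prime_gt_0_nat[OF p] unfolding presentation_def by auto
qed

lemma prime_power_decompose:
  fixes n p :: nat
  assumes "prime p" "n > 0"
  obtains s u where "n = p ^ s * u" "\<not> p dvd u" "u > 0"
proof -
  have "n \<noteq> 0" "\<not> is_unit p" using assms by auto
  then obtain u where u: "n = p ^ multiplicity p n * u" "\<not> p dvd u"
    by (rule multiplicity_decompose')
  then have "u > 0" by (auto intro: gr0I)
  then show ?thesis by (rule that[OF u])
qed

text \<open>Base \<open>p\<close> works. For \<open>j = 0\<close>, multiplying by
  \<open>p ^ k\<close> only shifts the argument of \<open>f1\<close>. For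
  \<open>j = p ^ s * u\<close> with \<open>0 < j < p ^ k\<close>, the valuation of
  \<open>p ^ k * n + j\<close> is constantly \<open>s\<close>, so the sequence is a constant times
  \<open>f2\<close> along an arithmetic progression whose parameters matter only modulo
  \<open>d\<close>.\<close>

lemma presentation_periodic_imp_automatic:
  assumes pres: "presentation a p f1 f2" and "periodic f2"
  shows "automatic a"
proof -
  have p: "prime p" and ev: "eventually_periodic f1"
    using pres by (simp_all add: presentation_def)
  obtain d where d: "has_period f2 d" using assms(2) by (auto simp: periodic_def)
  then have "d \<ge> 1" by (simp add: has_period_def)
  define G where "G = (\<lambda>k. restrict (\<lambda>n. f1 (k + multiplicity p n) * f2 (n div p ^ multiplicity p n)) {1..})"
  \<comment> \<open>The summand \<open>d\<close> keeps the argument of \<open>f2\<close> positive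
    even if both residues are 0, as \<open>has_period\<close> says nothing about position 0.\<close>
  define H where "H = (\<lambda>(c, t, u). restrict (\<lambda>n. c * f2 (t * n + u + d)) {1..})"
  \<comment> \<open>One threshold serves all \<open>n\<close>, since the valuation of
    \<open>n\<close> only increases the argument of \<open>f1\<close>.\<close>
  have "eventually_periodic G"
  proof -
    obtain D N where D: "D \<ge> 1" "\<And>n. n \<ge> N \<Longrightarrow> f1 (n + D) = f1 n"
      using ev unfolding eventually_periodic_def by blast
    have "G (k + D) = G k" if "k \<ge> N" for k
      unfolding G_def using D(2)[of "k + _"] that
      by (intro restrict_ext) (simp add: add.assoc add.commute[of D])
    then show ?thesis using D(1) unfolding eventually_periodic_def by blast
  qed
  then have "finite (range G)" by (rule eventually_periodic_finite_range)
  moreover have "finite (H ` (range f1 \<times> {..<d} \<times> {..<d}))"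
    using eventually_periodic_finite_range[OF ev] by simp
  moreover have "kernel p a \<subseteq> range G \<union> H ` (range f1 \<times> {..<d} \<times> {..<d})"
  proof
    fix x assume "x \<in> kernel p a"
    then obtain k j where x: "x = restrict (\<lambda>n. a (p ^ k * n + j)) {1..}" and j: "j < p ^ k"
      unfolding kernel_def by blast
    show "x \<in> range G \<union> H ` (range f1 \<times> {..<d} \<times> {..<d})"
    proof (cases "j = 0")
      case True
      have "a (p ^ k * n + j) = f1 (k + multiplicity p n) * f2 (n div p ^ multiplicity p n)"
        if n1: "n \<ge> 1" for n
      proof -
        obtain s u where n: "n = p ^ s * u" "\<not> p dvd u" "u > 0"
          using prime_power_decompose[OF p] n1 by (metis less_eq_Suc_le One_nat_def)
        have "multiplicity p n = s" using n p by (intro multiplicity_eqI) auto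
        moreover have "a (p ^ k * n) = f1 (k + s) * f2 u"
          using presentation_multiplicity[OF pres n(2,3), of "k + s"]
          by (simp add: n(1) power_add mult.assoc)
        ultimately show ?thesis using True n(1) prime_gt_0_nat[OF p] by simp
      qed
      then have "x = G k" unfolding x G_def by (intro restrict_ext) simp
      then show ?thesis by blast
    next
      case False
      then obtain s u where u: "j = p ^ s * u" "\<not> p dvd u" "u > 0"
        using prime_power_decompose[OF p] by blast
      have "p ^ s < p ^ k" using u(1,3) j
        by (metis One_nat_def Suc_leI dual_order.strict_trans2 le_eq_less_or_eq mult.right_neutral mult_le_mono2 nat_mult_1_right)
      then have sk: "s < k" using prime_gt_1_nat[OF p] by simp
      have "x = H (f1 s, p ^ (k - s) mod d, u mod d)"
        unfolding x H_def prod.case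
      proof (rule restrict_ext)
        fix n :: nat assume "n \<in> {1..}"
        define v where "v = p ^ (k - s) * n + u"
        have "p dvd p ^ (k - s) * n" using sk by simp
        then have "\<not> p dvd v" "v > 0" using u unfolding v_def
          by (simp_all add: dvd_add_right_iff)
        moreover have "p ^ k * n + j = p ^ s * v"
          using sk by (simp add: v_def u(1) algebra_simps flip: power_add)
        ultimately have "a (p ^ k * n + j) = f1 s * f2 v"
          using presentation_multiplicity[OF pres] by simp
        moreover have "f2 (p ^ (k - s) mod d * n + u mod d + d) = f2 v"
        proof (rule has_period_cong[OF d])
          show "[p ^ (k - s) mod d * n + u mod d + d = v] (mod d)"
          proof -
            have "[p ^ (k - s) mod d * n + u mod d + d = p ^ (k - s) * n + u + 0] (mod d)"
              by (intro cong_add cong_mult) (auto simp: cong_def)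
            then show ?thesis by (simp add: v_def)
          qed
        qed (use \<open>v > 0\<close> \<open>d \<ge> 1\<close> in auto)
        ultimately show "a (p ^ k * n + j) = f1 s * f2 (p ^ (k - s) mod d * n + u mod d + d)"
          by simp
      qed
      moreover have "(f1 s, p ^ (k - s) mod d, u mod d) \<in> range f1 \<times> {..<d} \<times> {..<d}"
        using \<open>d \<ge> 1\<close> by auto
      ultimately show ?thesis by blast
    qed
  qed
  ultimately have "finite (kernel p a)" by (meson finite_UnI finite_subset)
  then show ?thesis unfolding automatic_def using prime_ge_2_nat[OF p] by blast
qed

section \<open>Toeplitz property of nonsingular sequences\<close>

text \<open>The factor \<open>p ^ (s + 1)\<close> of the modulus fixes the valuation
  \<open>s\<close>; after cancelling \<open>p ^ s\<close>, the factor \<open>d\<close> fixes the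
  cofactor modulo \<open>d\<close>.\<close>

lemma presentation_in_Per:
  assumes pres: "presentation f p f1 f2" and d: "has_period f2 d" and "n \<ge> 1"
  shows "\<exists>L. n \<in> Per (p ^ L * d) f"
proof -
  have p: "prime p" using pres by (simp add: presentation_def)
  obtain s u where n: "n = p ^ s * u" "\<not> p dvd u" "u > 0"
    using prime_power_decompose[OF p] assms(3) by (metis less_eq_Suc_le One_nat_def)
  have "n \<in> Per (p ^ Suc s * d) f"
    using assms(3)
  proof (rule PerI)
    fix n' :: nat assume n': "n' \<ge> 1" "[n' = n] (mod p ^ Suc s * d)"
    have "p ^ s dvd p ^ Suc s * d" by simp
    then have "p ^ s dvd n'"
      using n'(2) n(1) by (metis cong_dvd_iff cong_dvd_modulus_nat dvd_triv_left)
    then obtain v where v: "n' = p ^ s * v" by blast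
    have "[v = u] (mod p * d)"
      using n'(2) prime_gt_0_nat[OF p]
      by (simp add: v n(1) cong_def mult.commute[of p] mult.assoc mod_mult_mult1)
    then have "[v = u] (mod d)" "[v = u] (mod p)"
      by (rule cong_dvd_modulus_nat; simp)+
    then have "\<not> p dvd v" "v > 0"
      using n(2) v n'(1) by (auto simp: cong_dvd_iff)
    then show "f n' = f n"
      unfolding v n(1) presentation_multiplicity[OF pres n(2,3)]
      using presentation_multiplicity[OF pres, of v s]
        has_period_cong[OF d _ _ \<open>[v = u] (mod d)\<close>] n(3) by simp
  qed
  then show ?thesis by blast
qed

lemma period_structure_bounded_imp_periodic:
  assumes "period_structure f e" "D > 0" "\<And>i. e i dvd D"
  shows "periodic f"
proof -
  have cover: "{1..} = (\<Union>k. Per (e k) f)"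
    using assms(1) unfolding period_structure_def by blast
  have "n \<in> Per D f" if "n \<ge> 1" for n
  proof -
    have "n \<in> (\<Union>k. Per (e k) f)"
      using that unfolding cover[symmetric] by simp
    then show ?thesis using Per_mono[OF assms(3)] by blast
  qed
  then have "has_period f D"
    using assms(2) by (intro has_period_of_cong PerD(1)) auto
  then show ?thesis unfolding periodic_def by blast
qed

lemma nonsingular_imp_toeplitz:
  assumes "nonsingular f" "\<not> periodic f"
  shows "toeplitz f \<and> (\<exists>!p. prime p \<and> nu_Per p f = \<infinity>) \<and>
      (\<forall>p. prime p \<and> nu_Per p f = \<infinity> \<longrightarrow> eventually_periodic (\<lambda>k. f (p ^ k)))"
proof -
  obtain p f1 f2 d where pres: "presentation f p f1 f2" and d: "has_period f2 d"
    using assms(1) unfolding nonsingular_def periodic_def by blast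
  have p: "prime p" and ev: "eventually_periodic f1"
    using pres by (simp_all add: presentation_def)
  have "d > 0" using d by (simp add: has_period_def)
  have pos: "p ^ L * d > 0" for L using \<open>d > 0\<close> prime_gt_0_nat[OF p] by simp
  have cover: "\<exists>L. n \<in> Per (p ^ L * d) f" if "n \<ge> 1" for n
    using presentation_in_Per[OF pres d that] .
  have top: "toeplitz f"
    unfolding toeplitz_def
  proof (intro equalityI subsetI)
    fix n :: nat assume "n \<in> {1..}"
    then obtain L where "n \<in> Per (p ^ L * d) f" using cover by auto
    moreover have "p ^ L * d \<in> {1..}" unfolding atLeast_iff using pos[of L] by linarith
    ultimately show "n \<in> (\<Union>m\<in>{1..}. Per m f)" by blast
  qed (auto simp: Per_def)
  obtain e where e: "period_structure f e"
    and nu: "\<And>p. nu_Per p f = \<infinity> \<longleftrightarrow> (\<forall>b. \<exists>i. p ^ b dvd e i)"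
    using toeplitz_nu_Per[OF top] by blast
  have dvd: "\<exists>L. e i dvd p ^ L * d" for i
    using e pos cover by (intro essential_period_dvd_chain) (auto simp: period_structure_def)
  have nu_p: "nu_Per p f = \<infinity>"
  proof (rule ccontr)
    assume "nu_Per p f \<noteq> \<infinity>"
    then obtain b where b: "\<And>i. \<not> p ^ b dvd e i" unfolding nu by blast
    \<comment> \<open>The part of \<open>e i\<close> prime to \<open>p\<close> divides
      \<open>d\<close>, and the exponent of \<open>p\<close> is at most \<open>b\<close>. Such a
      common multiple of all \<open>e i\<close> would make \<open>f\<close> periodic.\<close>
    have "e i dvd p ^ b * d" for i
    proof -
      have "e i > 0" using e essential_period_pos unfolding period_structure_def by blast
      then obtain s u where u: "e i = p ^ s * u" "\<not> p dvd u" "u > 0"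
        using prime_power_decompose[OF p] by blast
      have "s \<le> b" using b[of i] u(1) by (metis dvd_mult2 le_imp_power_dvd nle_le)
      obtain L where "e i dvd p ^ L * d" using dvd by blast
      then have "u dvd p ^ L * d" unfolding u(1) by (rule dvd_mult_right)
      moreover have "coprime u (p ^ L)" using u(2) p
        by (metis coprime_commute coprime_power_left_iff prime_imp_coprime)
      ultimately have "u dvd d" by (simp add: coprime_dvd_mult_right_iff)
      then show ?thesis using \<open>s \<le> b\<close> u(1) by (simp add: le_imp_power_dvd mult_dvd_mono)
    qed
    then show False using period_structure_bounded_imp_periodic[OF e pos] assms(2) by blast
  qed
  have uniq: "q = p" if q: "prime q" "nu_Per q f = \<infinity>" for q
  proof (rule ccontr)
    assume "q \<noteq> p"
    \<comment> \<open>The exponent \<open>d\<close> is chosen because \<open>q ^ d > d\<close>, so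
      \<open>q ^ d\<close> cannot divide \<open>d\<close>.\<close>
    obtain i where "q ^ d dvd e i" using nu q(2) by blast
    then obtain L where "q ^ d dvd p ^ L * d" using dvd dvd_trans by blast
    moreover have "coprime (q ^ d) (p ^ L)"
      using primes_coprime[OF q(1) p \<open>q \<noteq> p\<close>] by simp
    ultimately have "q ^ d dvd d" by (metis coprime_dvd_mult_right_iff)
    then have "q ^ d \<le> d" using \<open>d > 0\<close> dvd_imp_le by blast
    moreover have "d < q ^ d" using prime_gt_1_nat[OF q(1)] by (simp add: power_gt_expt)
    ultimately show False by simp
  qed
  have "eventually_periodic (\<lambda>k. f (p ^ k))"
  proof -
    have "f (p ^ k) = f1 k * f2 1" for k
      using presentation_multiplicity[OF pres, of 1 k] prime_gt_1_nat[OF p] by auto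
    then show ?thesis using ev unfolding eventually_periodic_def by metis
  qed
  then show ?thesis using top nu_p uniq p by blast
qed

section \<open>Multiplicative sequences\<close>

lemma multiplicative_one:
  assumes "multiplicative f" "\<exists>n\<ge>1. f n \<noteq> 0"
  shows "f 1 = 1"
proof -
  obtain n where "n \<ge> 1" "f n \<noteq> 0" using assms(2) by blast
  then have "f (n * 1) = f n * f 1"
    using assms(1) unfolding multiplicative_def by (metis coprime_1_right order_refl)
  then show ?thesis using \<open>f n \<noteq> 0\<close> by simp
qed

text \<open>The presentation takes the values at powers of \<open>p\<close> as first factor and
  \<open>f\<close> with the multiples of \<open>p\<close> set to 0 as second factor.\<close>

lemma automatic_nonsingularI:
  assumes mult: "multiplicative f" and one: "f 1 = 1" and p: "prime p"
    and ev: "eventually_periodic (\<lambda>k. f (p ^ k))"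
    and per: "periodic (\<lambda>n. if p dvd n then 0 else f n)" (is "periodic ?g")
  shows "automatic f \<and> nonsingular f"
proof -
  obtain d where "d \<ge> 1" "\<forall>n\<ge>1. ?g (n + d) = ?g n"
    using per unfolding periodic_def has_period_def by blast
  then have ev_g: "eventually_periodic ?g"
    unfolding eventually_periodic_def by (intro exI[of _ d] exI[of _ 1] conjI)
  have mult_g: "multiplicative ?g"
    unfolding multiplicative_def
  proof (intro allI impI)
    fix m n :: nat assume "m \<ge> 1" "n \<ge> 1" "coprime m n"
    then have "f (m * n) = f m * f n" using mult unfolding multiplicative_def by blast
    then show "?g (m * n) = ?g m * ?g n" by (simp add: prime_dvd_mult_iff[OF p])
  qed
  have f_eq: "f n = f (p ^ multiplicity p n) * ?g (n div p ^ multiplicity p n)" if n: "n \<ge> 1" for n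
  proof -
    obtain s u where u: "n = p ^ s * u" "\<not> p dvd u" "u > 0"
      using prime_power_decompose[OF p] n by (metis less_eq_Suc_le One_nat_def)
    have s: "multiplicity p n = s" using u p by (intro multiplicity_eqI) auto
    have "coprime (p ^ s) u" using u(2) p by (simp add: prime_imp_coprime)
    moreover have "p ^ s \<ge> 1" "u \<ge> 1" using u(3) prime_gt_0_nat[OF p] by simp_all
    ultimately have "f n = f (p ^ s) * f u"
      unfolding u(1) using mult unfolding multiplicative_def by blast
    then show ?thesis unfolding s using u prime_gt_0_nat[OF p] by simp
  qed
  have pres: "presentation f p (\<lambda>k. f (p ^ k)) ?g"
    unfolding presentation_def
  proof (intro conjI allI impI)
    show "f (p ^ 0) = 1" using one by simp
    show "?g (p ^ k) = 0" if "k \<ge> 1" for k using that by simp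
  qed (fact p ev ev_g mult_g f_eq)+
  have "?g 1 \<noteq> 0" using one prime_gt_1_nat[OF p] by simp
  then have "\<exists>n\<ge>1. ?g n \<noteq> 0" by (rule exI[of _ 1, OF conjI[OF order_refl]])
  then have "presentation f p (\<lambda>k. f (p ^ k)) ?g \<and> (\<exists>n\<ge>1. ?g n \<noteq> 0) \<and> periodic ?g"
    using pres per by (intro conjI)
  then have "nonsingular f"
    unfolding nonsingular_def by (intro exI)
  then show ?thesis using presentation_periodic_imp_automatic[OF pres per] by blast
qed

text \<open>By pigeonhole two powers of \<open>p\<close> agree modulo a period of \<open>f\<close>;
  multiplying by further powers of \<open>p\<close> propagates the congruence.\<close>

lemma periodic_imp_eventually_periodic_powers:
  assumes "periodic f" "p > 0"
  shows "eventually_periodic (\<lambda>k. f (p ^ k))"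
proof -
  obtain d where d: "has_period f d" using assms(1) by (auto simp: periodic_def)
  have "range (\<lambda>k. p ^ k mod d) \<subseteq> {..<d}" using d by (auto simp: has_period_def)
  then have "finite (range (\<lambda>k. p ^ k mod d))" using finite_subset by blast
  then have "\<not> inj (\<lambda>k. p ^ k mod d)" using finite_imageD by blast
  then obtain i j where ij: "i < j" "[p ^ i = p ^ j] (mod d)"
    unfolding inj_def cong_def by (metis nat_neq_iff)
  have "f (p ^ (n + (j - i))) = f (p ^ n)" if "n \<ge> i" for n
  proof (rule has_period_cong[OF d])
    have "n + (j - i) = j + (n - i)" "n = i + (n - i)" using that ij(1) by auto
    moreover have "[p ^ j * p ^ (n - i) = p ^ i * p ^ (n - i)] (mod d)"
      using ij(2) by (intro cong_mult) (auto simp: cong_sym)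
    ultimately show "[p ^ (n + (j - i)) = p ^ n] (mod d)" by (metis power_add)
  qed (use assms(2) in \<open>simp_all add: Suc_le_eq\<close>)
  then show ?thesis using ij(1) unfolding eventually_periodic_def
    by (intro exI[of _ "j - i"] conjI exI[of _ i]) auto
qed

text \<open>The prime 2 is an arbitrary choice: setting a periodic function to 0 on the multiples of
  any prime keeps it periodic.\<close>

lemma periodic_imp_automatic_nonsingular:
  assumes "multiplicative f" "f 1 = 1" "periodic f"
  shows "automatic f \<and> nonsingular f"
proof -
  obtain d where d: "has_period f d" using assms(3) by (auto simp: periodic_def)
  have "has_period (\<lambda>n. if 2 dvd n then 0 else f n) (2 * d)"
  proof (rule has_period_of_cong)
    fix n n' :: nat assume *: "n \<ge> 1" "n' \<ge> 1" "[n' = n] (mod 2 * d)"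
    then have "[n' = n] (mod 2)" "[n' = n] (mod d)"
      using cong_dvd_modulus_nat[OF *(3)] by simp_all
    then show "(if 2 dvd n' then 0 else f n') = (if 2 dvd n then 0 else f n)"
      using has_period_cong[OF d *(1,2)] cong_dvd_iff[of n' n 2] by simp
  qed (use d in \<open>auto simp: has_period_def\<close>)
  then have "periodic (\<lambda>n. if 2 dvd n then 0 else f n)"
    unfolding periodic_def by blast
  then show ?thesis
    using periodic_imp_eventually_periodic_powers[OF assms(3), of 2]
    by (intro automatic_nonsingularI[OF assms(1,2) two_is_prime_nat]) simp_all
qed

text \<open>Both \<open>n\<close> and \<open>n'\<close> have a common inverse \<open>k\<close> modulo \<open>m\<close> coprime to both,
  so \<open>f k * f n = 1 = f k * f n'\<close>.\<close>
lemma multiplicative_cong_coprime: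
  assumes mult: "multiplicative f" and one: "f 1 = 1" and m: "1 \<in> Per m f"
    and n: "n \<ge> 1" "n' \<ge> 1" "coprime n m" "[n' = n] (mod m)"
  shows "f n' = f n"
proof -
  have n'm: "coprime n' m" using n by (metis cong_imp_coprime cong_sym)
  obtain x where x: "[n * x = 1] (mod m)"
    using cong_solve_coprime_nat[OF n(3)] by auto
  have "coprime m (n * n')" using n(3) n'm by (simp add: coprime_commute)
  then obtain k where k: "[k = x] (mod m)" "[k = 1] (mod (n * n'))"
    using binary_chinese_remainder_nat by blast
  \<comment> \<open>Adding a multiple of both moduli preserves the congruences and makes the inverse
    positive when \<open>m > 0\<close>. For \<open>m = 0\<close> congruence is equality.\<close>
  define K where "K = k + m * (n * n')"
  show ?thesis
  proof (cases "m = 0")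
    case True
    then show ?thesis using n(4) by (simp add: cong_def)
  next
    case False
    have K: "K \<ge> 1" using False n by (simp add: K_def Suc_le_eq)
    have "[K = 1] (mod (n * n'))" using k(2) by (simp add: K_def cong_def)
    then have "coprime K (n * n')" by (metis cong_imp_coprime cong_sym coprime_1_left)
    then have cop: "coprime K n" "coprime K n'" by auto
    have Kx: "[K = x] (mod m)" using k(1) by (simp add: K_def cong_def)
    have inv: "f (K * y) = 1" if "y \<ge> 1" "[y = n] (mod m)" for y
    proof -
      have "[K * y = x * n] (mod m)" using Kx that(2) by (rule cong_mult)
      then have "[K * y = 1] (mod m)" using x by (metis cong_trans mult.commute)
      then show ?thesis using PerD(1)[OF m] that(1) K one by (metis mult_le_mono mult_1)
    qed
    have "f K * f n = 1" "f K * f n' = 1"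
      using inv[of n] inv[of n'] n K cop mult unfolding multiplicative_def by auto
    then show ?thesis by (metis mult_cancel_left mult_zero_left zero_neq_one)
  qed
qed

section \<open>Period structure of multiplicative Toeplitz functions\<close>

text \<open>\<open>gcd n m\<close> is divided out until the rest is coprime to \<open>m\<close>. The
  removed factors each divide \<open>m\<close>, so their product \<open>a\<close> divides a power of
  \<open>m\<close>.\<close>

lemma coprime_part_decompose:
  fixes n m :: nat
  assumes "n \<ge> 1"
  shows "\<exists>a b L. n = a * b \<and> a dvd m ^ L \<and> coprime b m"
  using assms
proof (induction n rule: less_induct)
  case (less n)
  show ?case
  proof (cases "coprime n m")
    case True
    then show ?thesis by (intro exI[of _ 1] exI[of _ n]) auto
  next
    case False
    define g where "g = gcd n m"
    have g: "g \<noteq> 1" using False by (simp add: g_def coprime_iff_gcd_eq_1)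
    obtain n1 where n1: "n = g * n1" unfolding g_def by (meson dvdE gcd_dvd1)
    then have "g > 0" "n1 \<ge> 1" using less.prems by (auto intro: gr0I)
    then have "n1 < n" using g n1 by simp
    then obtain a b L where *: "n1 = a * b" "a dvd m ^ L" "coprime b m"
      using less.IH \<open>n1 \<ge> 1\<close> by blast
    have "g dvd m" by (simp add: g_def)
    then have "g * a dvd m ^ Suc L" using *(2) by (simp add: mult_dvd_mono)
    then show ?thesis using * n1 by (metis mult.assoc)
  qed
qed

text \<open>Congruence modulo \<open>m ^ (L + 1)\<close> forces \<open>a\<close> to divide
  \<open>n'\<close>. The extra factor \<open>m\<close> survives the cancellation of
  \<open>a\<close>, so the cofactors agree modulo \<open>m\<close>, which determines
  \<open>f\<close> on numbers coprime to \<open>m\<close>.\<close>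

lemma multiplicative_in_Per_power:
  assumes mult: "multiplicative f" and one: "f 1 = 1" and m: "1 \<in> Per m f" "m > 0"
    and n: "n \<ge> 1"
  shows "\<exists>L. n \<in> Per (m ^ L) f"
proof -
  obtain a b L where ab: "n = a * b" "a dvd m ^ L" "coprime b m"
    using coprime_part_decompose[OF n] by blast
  obtain t where t: "m ^ L = a * t" using ab(2) by blast
  have pos: "a \<ge> 1" "b \<ge> 1" using n ab(1) by (auto simp: Suc_le_eq)
  have split: "f (a * c) = f a * f c" if "c \<ge> 1" "coprime c m" for c
  proof -
    have "coprime a c" using ab(2) that(2)
      by (metis coprime_commute coprime_divisors coprime_power_right_iff dvd_refl)
    then show ?thesis using mult pos that unfolding multiplicative_def by blast
  qed
  have "n \<in> Per (m ^ Suc L) f"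
    using n
  proof (rule PerI)
    fix n' :: nat assume n': "n' \<ge> 1" "[n' = n] (mod m ^ Suc L)"
    have "a dvd m ^ Suc L" using ab(2) by (simp add: dvd_mult)
    then have "a dvd n'" using n'(2) ab(1)
      by (metis cong_dvd_iff cong_dvd_modulus_nat dvd_triv_left)
    then obtain c where c: "n' = a * c" by blast
    have "m ^ Suc L = a * (t * m)" using t by simp
    then have "[a * c = a * b] (mod a * (t * m))"
      using n'(2) c ab(1) by metis
    then have "[c = b] (mod t * m)"
      using pos(1) by (simp add: cong_def mod_mult_mult1)
    then have cb: "[c = b] (mod m)" by (rule cong_dvd_modulus_nat) simp
    have "c \<ge> 1" using n'(1) c by (auto simp: Suc_le_eq)
    moreover have "coprime c m" using cb ab(3) by (metis cong_imp_coprime cong_sym)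
    moreover have "f c = f b"
      using multiplicative_cong_coprime[OF mult one m(1) pos(2) \<open>c \<ge> 1\<close> ab(3) cb] .
    ultimately show "f n' = f n" using split pos(2) ab c by simp
  qed
  then show ?thesis by blast
qed

text \<open>\<open>Q\<close> gathers, for each prime \<open>q\<close> of \<open>m\<close> other than
  \<open>p\<close>, a power \<open>q ^ B q\<close> that divides no \<open>e i\<close>. Every
  \<open>e i\<close> divides a power of \<open>m\<close>, so its part prime to \<open>p\<close>
  divides \<open>Q\<close>.\<close>

lemma multiplicative_toeplitz_cover:
  assumes mult: "multiplicative f" and one: "f 1 = 1" and top: "toeplitz f"
    and p: "prime p" and uniq: "\<And>q. prime q \<Longrightarrow> nu_Per q f = \<infinity> \<Longrightarrow> q = p"
  obtains Q where "Q > 0" "\<not> p dvd Q" "\<And>n. n \<ge> 1 \<Longrightarrow> \<exists>L. n \<in> Per (p ^ L * Q) f"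
proof -
  obtain e where e: "period_structure f e"
    and nu: "\<And>p. nu_Per p f = \<infinity> \<longleftrightarrow> (\<forall>b. \<exists>i. p ^ b dvd e i)"
    using toeplitz_nu_Per[OF top] by blast
  obtain m where m: "m > 0" "1 \<in> Per m f"
    using top unfolding toeplitz_def by (metis UN_E atLeast_iff le_refl less_eq_Suc_le One_nat_def)
  have "\<forall>q. \<exists>b. prime q \<and> q \<noteq> p \<longrightarrow> (\<forall>i. \<not> q ^ b dvd e i)"
    using nu uniq by blast
  then obtain B where B: "\<And>q i. prime q \<Longrightarrow> q \<noteq> p \<Longrightarrow> \<not> q ^ B q dvd e i"
    by metis
  define S where "S = prime_factors m - {p}"
  define Q where "Q = (\<Prod>q\<in>S. q ^ B q)"
  have S: "finite S" "\<And>q. q \<in> S \<longleftrightarrow> prime q \<and> q dvd m \<and> q \<noteq> p"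
    using m(1) by (auto simp: S_def in_prime_factors_iff)
  have "Q > 0" unfolding Q_def using S by (auto intro!: prod_pos simp: prime_gt_0_nat)
  have "\<not> p dvd Q"
  proof
    assume "p dvd Q"
    then obtain q where "q \<in> S" "p dvd q ^ B q"
      using S(1) p unfolding Q_def by (auto simp: prime_dvd_prod_iff)
    then show False using S(2) p by (metis prime_dvd_power primes_dvd_imp_eq)
  qed
  have e_dvd: "e i dvd p ^ multiplicity p (e i) * Q" (is "_ dvd ?R") for i
  proof -
    have ess: "essential_period f (e i)" using e by (simp add: period_structure_def)
    have ei: "e i > 0" using essential_period_pos[OF ess] .
    have R: "?R \<noteq> 0" using \<open>Q > 0\<close> prime_gt_0_nat[OF p] by simp
    obtain L where L: "e i dvd m ^ L"
      using essential_period_dvd_chain[OF ess, of "\<lambda>k. m ^ k"]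
        multiplicative_in_Per_power[OF mult one m(2,1)] m(1) by auto
    \<comment> \<open>Divisibility is checked prime by prime; the first case covers the primes of
      \<open>e i\<close> other than \<open>p\<close>, all of which divide \<open>m\<close>.\<close>
    have "multiplicity q (e i) \<le> multiplicity q ?R" if q: "prime q" for q
    proof (cases "q dvd e i \<and> q \<noteq> p")
      case True
      then have "q dvd m" using L q by (meson dvd_trans prime_dvd_power)
      then have "q ^ B q dvd Q" unfolding Q_def using S q True by (intro dvd_prodI) auto
      then have "B q \<le> multiplicity q ?R"
        using R q by (intro multiplicity_geI) (auto simp: prime_gt_1_nat)
      moreover have "multiplicity q (e i) < B q"
        using B[OF q, of i] True ei q by (intro multiplicity_lessI) (auto simp: prime_gt_1_nat)
      ultimately show ?thesis by simp
    next
      case False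
      then show ?thesis
        using R p prime_gt_0_nat[OF p]
        by (auto simp: not_dvd_imp_multiplicity_0 prime_gt_1_nat intro!: multiplicity_geI)
    qed
    then show ?thesis using ei R by (intro multiplicity_le_imp_dvd) auto
  qed
  have "\<exists>L. n \<in> Per (p ^ L * Q) f" if "n \<ge> 1" for n
  proof -
    have "{1..} = (\<Union>k. Per (e k) f)"
      using e unfolding period_structure_def by blast
    then have "n \<in> (\<Union>k. Per (e k) f)"
      using that by (metis atLeast_iff)
    then show ?thesis using Per_mono[OF e_dvd] by blast
  qed
  then show ?thesis using that[OF \<open>Q > 0\<close> \<open>\<not> p dvd Q\<close>] by blast
qed

text \<open>If \<open>n'\<close> is congruent to \<open>n\<close> modulo \<open>p * m * Q\<close>, where \<open>1 \<in> Per m f\<close>, there is a multiplier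
  \<open>k\<close> congruent to 1 modulo \<open>m\<close> (so \<open>f k = 1\<close>) and coprime to \<open>n\<close> that moves \<open>n\<close> into the class of
  \<open>n'\<close> modulo \<open>p ^ L * Q\<close>, however large \<open>L\<close> is.\<close>
lemma multiplicative_toeplitz_periodic_off_prime:
  assumes mult: "multiplicative f" and one: "f 1 = 1" and top: "toeplitz f"
    and p: "prime p" and uniq: "\<And>q. prime q \<Longrightarrow> nu_Per q f = \<infinity> \<Longrightarrow> q = p"
  shows "periodic (\<lambda>n. if p dvd n then 0 else f n)"
proof -
  obtain Q where Q: "Q > 0" "\<not> p dvd Q"
    and cover: "\<And>n. n \<ge> 1 \<Longrightarrow> \<exists>L. n \<in> Per (p ^ L * Q) f"
    using multiplicative_toeplitz_cover[OF mult one top p] uniq by blast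
  obtain m where m: "m > 0" "1 \<in> Per m f"
    using top unfolding toeplitz_def by (metis UN_E atLeast_iff le_refl less_eq_Suc_le One_nat_def)
  obtain c m' where m': "m = p ^ c * m'" "\<not> p dvd m'" "m' > 0"
    using prime_power_decompose[OF p m(1)] .
  have main: "f n' = f n"
    if n: "n \<ge> 1" "n' \<ge> 1" "\<not> p dvd n" "[n' = n] (mod m)" "[n' = n] (mod Q)" for n n'
  proof -
    obtain L0 where "n' \<in> Per (p ^ L0 * Q) f" using cover n(2) by blast
    \<comment> \<open>\<open>L >= c\<close> lets congruences modulo \<open>p ^ L\<close> be reduced
      modulo \<open>p ^ c\<close>, the \<open>p\<close>-part of \<open>m\<close>.\<close>
    define L where "L = max L0 c"
    have "p ^ L0 * Q dvd p ^ L * Q" by (simp add: L_def le_imp_power_dvd mult_dvd_mono)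
    then have n'L: "n' \<in> Per (p ^ L * Q) f"
      using \<open>n' \<in> Per (p ^ L0 * Q) f\<close> Per_mono by blast
    have pn: "coprime n (p ^ L)" "coprime n (p ^ c)"
      using prime_imp_coprime[OF p n(3)] by (simp_all add: coprime_commute)
    obtain x where x: "[n * x = 1] (mod p ^ L)"
      using cong_solve_coprime_nat[OF pn(1)] by auto
    \<comment> \<open>\<open>R\<close> collects the moduli prime to \<open>p\<close> at which
      \<open>k\<close> has to be 1: \<open>m'\<close> towards \<open>f k = 1\<close>,
      \<open>Q\<close> to keep the class of \<open>n\<close>, and \<open>n\<close> for
      coprimality.\<close>
    define R where "R = m' * Q * n"
    have "\<not> p dvd R" using Q m' n p by (simp add: R_def prime_dvd_mult_iff)
    then have copR: "coprime (p ^ L) R" using p by (simp add: prime_imp_coprime)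
    obtain k0 where k0: "[k0 = x * n'] (mod p ^ L)" "[k0 = 1] (mod R)"
      using binary_chinese_remainder_nat[OF copR] by blast
    define k where "k = k0 + p ^ L * R"
    have "R > 0" using \<open>\<not> p dvd R\<close> by (auto intro: gr0I)
    then have "k \<ge> 1" using prime_gt_0_nat[OF p] by (simp add: k_def Suc_le_eq)
    have k: "[k = x * n'] (mod p ^ L)" "[k = 1] (mod R)"
      using k0 by (simp_all add: k_def cong_def)
    have kd: "[k = 1] (mod m')" "[k = 1] (mod Q)" "[k = 1] (mod n)"
      using cong_dvd_modulus_nat[OF k(2)] by (simp_all add: R_def)
    have "[k * n = x * n' * n] (mod p ^ L)" using k(1) by (intro cong_mult) auto
    also have "x * n' * n = (n * x) * n'" by simp
    also have "[(n * x) * n' = 1 * n'] (mod p ^ L)" using x by (intro cong_mult) auto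
    finally have kn: "[k * n = n'] (mod p ^ L)" by simp
    \<comment> \<open>Modulo \<open>p ^ c\<close> also \<open>n'\<close> is congruent to
      \<open>n\<close>, so cancelling \<open>n\<close> shows that \<open>k\<close> is 1 modulo the
      \<open>p\<close>-part of \<open>m\<close> as well.\<close>
    have "[k * n = n'] (mod p ^ c)"
      using kn by (rule cong_dvd_modulus_nat) (simp add: L_def le_imp_power_dvd)
    also have "[n' = 1 * n] (mod p ^ c)"
      using n(4) by (simp add: m'(1)) (rule cong_dvd_modulus_nat, auto)
    finally have "[k = 1] (mod p ^ c)" using pn(2) cong_mult_rcancel_nat by blast
    moreover have "coprime (p ^ c) m'" using m'(2) p by (simp add: prime_imp_coprime)
    ultimately have "[k = 1] (mod m)" using kd(1) m'(1) coprime_cong_mult_nat by blast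
    then have "f k = 1" using PerD(1)[OF m(2) \<open>k \<ge> 1\<close>] one by simp
    moreover have "coprime k n" using kd(3) by (metis cong_imp_coprime cong_sym coprime_1_left)
    ultimately have "f (k * n) = f n"
      using mult \<open>k \<ge> 1\<close> n(1) unfolding multiplicative_def by simp
    moreover have "f (k * n) = f n'"
    proof (rule PerD(1)[OF n'L])
      show "k * n \<ge> 1" using \<open>k \<ge> 1\<close> n(1) by (simp add: Suc_le_eq)
      have "[k * n = 1 * n] (mod Q)" using kd(2) by (intro cong_mult) auto
      then have "[k * n = n'] (mod Q)" using n(5) by (metis cong_sym cong_trans mult_1)
      moreover have "coprime (p ^ L) Q" using Q(2) p by (simp add: prime_imp_coprime)
      ultimately show "[k * n = n'] (mod p ^ L * Q)" using kn coprime_cong_mult_nat by blast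
    qed
    ultimately show ?thesis by simp
  qed
  \<comment> \<open>The factor \<open>p\<close> makes divisibility by \<open>p\<close> depend only
    on the residue class; \<open>m\<close> and \<open>Q\<close> are the moduli in
    \<open>main\<close>.\<close>
  have "has_period (\<lambda>n. if p dvd n then 0 else f n) (p * m * Q)"
  proof (rule has_period_of_cong)
    show "p * m * Q \<ge> 1" using m Q prime_gt_0_nat[OF p] by (simp add: Suc_le_eq)
    fix n n' :: nat assume *: "n \<ge> 1" "n' \<ge> 1" "[n' = n] (mod p * m * Q)"
    have "[n' = n] (mod p)" "[n' = n] (mod m)" "[n' = n] (mod Q)"
      using cong_dvd_modulus_nat[OF *(3)] by simp_all
    then show "(if p dvd n' then 0 else f n') = (if p dvd n then 0 else f n)"
      using main[OF *(1,2)] cong_dvd_iff[of n' n p] by simp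
  qed
  then show ?thesis unfolding periodic_def by blast
qed

theorem proposition0p4:
  fixes f :: "nat \<Rightarrow> complex"
  assumes "multiplicative f"
    and "\<exists>n\<ge>1. f n \<noteq> 0"
  shows "(automatic f \<and> nonsingular f) \<longleftrightarrow>
    (periodic f \<or>
     (\<not> periodic f \<and> toeplitz f \<and>
      (\<exists>!p. prime p \<and> nu_Per p f = \<infinity>) \<and>
      (\<forall>p. prime p \<and> nu_Per p f = \<infinity> \<longrightarrow> eventually_periodic (\<lambda>k. f (p ^ k)))))"
    (is "?A \<longleftrightarrow> ?B")
proof
  assume ?A
  then show ?B using nonsingular_imp_toeplitz by blast
next
  assume B: ?B
  have one: "f 1 = 1" using multiplicative_one[OF assms] .
  show ?A
  proof (cases "periodic f")
    case True
    then show ?thesis using periodic_imp_automatic_nonsingular assms(1) one by blast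
  next
    case False
    then obtain p where p: "prime p" "nu_Per p f = \<infinity>" "toeplitz f"
      and uniq: "\<And>q. prime q \<Longrightarrow> nu_Per q f = \<infinity> \<Longrightarrow> q = p"
      and ev: "eventually_periodic (\<lambda>k. f (p ^ k))"
      using B by blast
    show ?thesis
      using automatic_nonsingularI[OF assms(1) one p(1) ev]
        multiplicative_toeplitz_periodic_off_prime[OF assms(1) one p(3,1)] uniq by blast
  qed
qed

end
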